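(* Fix integers $m,l$ and letters $a<b$ in $[m]$. All primitive subword patterns $\tau\in[m]^l$ with first letter $\tau_1=a$ and last letter $\tau_l=b$ are in the same strong Wilf class: for any two such patterns $\tau,\tau'$ and all $k\ge1$, $n\ge0$, $r\ge0$, the number of words in $[k]^n$ containing $\tau$ exactly $r$ times equals the number containing $\tau'$ exactly $r$ times.
   Context: $[k]^n$ is the set of words of length $n$ over $\{1,\dots,k\}$. A subword pattern is a word $\tau\in[m]^l$ containing every letter of $[m]$. An occurrence of $\tau$ in $\sigma=\sigma_1\cdots\sigma_n$ is an index $i$ such that the consecutive factor $\sigma_i\cdots\sigma_{i+l-1}$ is order-isomorphic to $\tau$ (same relative order and same equalities among positions); "containing exactly $r$ times" means having exactly $r$ occurrences. A subword pattern is primitive if any two distinct occurrences of it (in any word) overlap in at most one letter. *)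

theory Defs
  imports Main
begin

definition words :: "nat \<Rightarrow> nat \<Rightarrow> nat list set" where
  "words k n = {w. length w = n \<and> set w \<subseteq> {1..k}}"

definition subword_pattern :: "nat \<Rightarrow> nat \<Rightarrow> nat list \<Rightarrow> bool" where
  "subword_pattern m l \<tau> \<longleftrightarrow> \<tau> \<in> words m l \<and> set \<tau> = {1..m}"

definition order_isomorphic :: "nat list \<Rightarrow> nat list \<Rightarrow> bool" where
  "order_isomorphic u v \<longleftrightarrow> length u = length v \<and>
     (\<forall>i < length u. \<forall>j < length u.
        (u ! i < u ! j \<longleftrightarrow> v ! i < v ! j) \<and> (u ! i = u ! j \<longleftrightarrow> v ! i = v ! j))"

text \<open>Positions are counted from 0, so an occurrence at \<open>i\<close> is the factor
  occupying the positions \<open>{i..<i + length \<tau>}\<close>.\<close>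

definition occurrences :: "nat list \<Rightarrow> nat list \<Rightarrow> nat set" where
  "occurrences \<tau> \<sigma> = {i. i + length \<tau> \<le> length \<sigma> \<and>
     order_isomorphic (take (length \<tau>) (drop i \<sigma>)) \<tau>}"

definition primitive :: "nat list \<Rightarrow> bool" where
  "primitive \<tau> \<longleftrightarrow>
     (\<forall>k n. \<forall>\<sigma> \<in> words k n. \<forall>i \<in> occurrences \<tau> \<sigma>. \<forall>j \<in> occurrences \<tau> \<sigma>.
        i \<noteq> j \<longrightarrow> card ({i..<i + length \<tau>} \<inter> {j..<j + length \<tau>}) \<le> 1)"

definition strongly_Wilf_equivalent :: "nat list \<Rightarrow> nat list \<Rightarrow> bool" where
  "strongly_Wilf_equivalent \<tau> \<tau>' \<longleftrightarrow>
     (\<forall>k \<ge> 1. \<forall>n r.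
        card {\<sigma> \<in> words k n. card (occurrences \<tau> \<sigma>) = r} =
        card {\<sigma> \<in> words k n. card (occurrences \<tau>' \<sigma>) = r})"

end

theory Submission
  imports Defs
begin

text \<open>An occurrence of \<open>\<tau>\<close> on a set of \<open>m\<close> letters can be rewritten into an occurrence of
  \<open>\<tau>'\<close> on the same letters. The two patterns agree in their first and last letters, so the
  rewriting fixes the end letters of the factor and hence does not disturb occurrences that share
  at most one letter with it. Thus, for a set \<open>S\<close> of positions whose factors pairwise overlap in
  at most one letter, as many words have \<open>\<tau>\<close> at all positions of \<open>S\<close> (and possibly elsewhere)
  as have \<open>\<tau>'\<close> there; for other \<open>S\<close> primitivity makes both numbers zero. By inclusion-exclusion
  the numbers of words whose occurrence set is exactly \<open>S\<close> coincide as well.\<close>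

text \<open>Used with \<open>d = length \<tau> - 1\<close>, where it says that the factors starting
  at distinct positions of \<open>S\<close> share at most one letter.\<close>

definition spaced :: "nat \<Rightarrow> nat set \<Rightarrow> bool" where
  "spaced d S \<longleftrightarrow> (\<forall>i\<in>S. \<forall>j\<in>S. i < j \<longrightarrow> i + d \<le> j)"

text \<open>Any position of \<open>x\<close> serves: inside an occurrence, equal letters of the
  pattern lie over equal letters of the word.\<close>

definition letter_pos :: "'a list \<Rightarrow> 'a \<Rightarrow> nat" where
  "letter_pos \<tau> x = (SOME p. p < length \<tau> \<and> \<tau> ! p = x)"

text \<open>In an occurrence of \<open>\<tau>\<close> at \<open>i\<close>, each letter of
  \<open>\<tau>\<close> is represented by one letter of \<open>\<sigma>\<close>; the factor is
  overwritten by spelling \<open>\<tau>'\<close> with these representatives.\<close>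

definition rewrite_at :: "'a list \<Rightarrow> 'a list \<Rightarrow> nat \<Rightarrow> 'b list \<Rightarrow> 'b list" where
  "rewrite_at \<tau> \<tau>' i \<sigma> = map (\<lambda>p. if i \<le> p \<and> p < i + length \<tau>
     then \<sigma> ! (i + letter_pos \<tau> (\<tau>' ! (p - i))) else \<sigma> ! p) [0..<length \<sigma>]"

lemma letter_pos:
  assumes "x \<in> set \<tau>"
  shows "letter_pos \<tau> x < length \<tau>" "\<tau> ! letter_pos \<tau> x = x"
proof -
  have "\<exists>p. p < length \<tau> \<and> \<tau> ! p = x"
    using assms by (simp add: in_set_conv_nth)
  from someI_ex[OF this] show "letter_pos \<tau> x < length \<tau>" "\<tau> ! letter_pos \<tau> x = x"
    by (simp_all add: letter_pos_def)
qed

section \<open>Occurrences and their overlaps\<close>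

lemma in_occurrences_iff:
  "i \<in> occurrences \<tau> \<sigma> \<longleftrightarrow> i + length \<tau> \<le> length \<sigma> \<and>
     (\<forall>p < length \<tau>. \<forall>q < length \<tau>. (\<sigma> ! (i + p) < \<sigma> ! (i + q) \<longleftrightarrow> \<tau> ! p < \<tau> ! q) \<and>
        (\<sigma> ! (i + p) = \<sigma> ! (i + q) \<longleftrightarrow> \<tau> ! p = \<tau> ! q))"
  by (auto simp: occurrences_def order_isomorphic_def)

lemma occurrences_subset: "occurrences \<tau> \<sigma> \<subseteq> {..length \<sigma>}"
  by (auto simp: occurrences_def)

lemma finite_words: "finite (words k n)"
proof -
  have "words k n = {w. set w \<subseteq> {1..k} \<and> length w = n}"
    by (auto simp: words_def)
  then show ?thesis
    by (simp add: finite_lists_length_eq)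
qed

lemma primitive_spaced:
  assumes "primitive \<tau>" "\<sigma> \<in> words k n"
  shows "spaced (length \<tau> - 1) (occurrences \<tau> \<sigma>)"
  unfolding spaced_def
proof (intro ballI impI)
  fix i j assume ij: "i \<in> occurrences \<tau> \<sigma>" "j \<in> occurrences \<tau> \<sigma>" "i < j"
  have "card ({i..<i + length \<tau>} \<inter> {j..<j + length \<tau>}) \<le> 1"
    using ij(3) by (intro assms(1)[unfolded primitive_def, rule_format, OF assms(2) ij(1,2)]) simp
  moreover have "{i..<i + length \<tau>} \<inter> {j..<j + length \<tau>} = {j..<i + length \<tau>}"
    using ij(3) by auto
  ultimately show "i + (length \<tau> - 1) \<le> j"
    using ij(3) by simp
qed

lemma length_rewrite_at [simp]: "length (rewrite_at \<tau> \<tau>' i \<sigma>) = length \<sigma>"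
  by (simp add: rewrite_at_def)

lemma nth_rewrite_at:
  "p < length \<sigma> \<Longrightarrow> rewrite_at \<tau> \<tau>' i \<sigma> ! p = (if i \<le> p \<and> p < i + length \<tau>
     then \<sigma> ! (i + letter_pos \<tau> (\<tau>' ! (p - i))) else \<sigma> ! p)"
  by (simp add: rewrite_at_def)

lemma occurrences_cong:
  assumes "length \<sigma> = length \<sigma>'" "\<And>p. p < length \<tau> \<Longrightarrow> \<sigma> ! (j + p) = \<sigma>' ! (j + p)"
  shows "j \<in> occurrences \<tau> \<sigma> \<longleftrightarrow> j \<in> occurrences \<tau> \<sigma>'"
  using assms by (simp add: in_occurrences_iff)

text \<open>Makes the choice in \<open>letter_pos\<close> harmless: the chosen position and
  \<open>q\<close> carry the same pattern letter, hence the same letter of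
  \<open>\<sigma>\<close>.\<close>

lemma nth_letter_pos_occurrence:
  assumes "i \<in> occurrences \<tau> \<sigma>" "q < length \<tau>"
  shows "\<sigma> ! (i + letter_pos \<tau> (\<tau> ! q)) = \<sigma> ! (i + q)"
  using assms letter_pos[of "\<tau> ! q" \<tau>] by (simp add: in_occurrences_iff)

section \<open>Rewriting a single occurrence in place\<close>

context
  fixes \<tau> \<tau>' :: "nat list"
  assumes len: "length \<tau> = length \<tau>'" and letters: "set \<tau> = set \<tau>'" and ne: "\<tau> \<noteq> []"
    and hd: "hd \<tau> = hd \<tau>'" and last: "last \<tau> = last \<tau>'"
begin

lemma letter_pos_nth:
  assumes "p < length \<tau>"
  shows "letter_pos \<tau> (\<tau>' ! p) < length \<tau>" "\<tau> ! letter_pos \<tau> (\<tau>' ! p) = \<tau>' ! p"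
  using letter_pos[of "\<tau>' ! p" \<tau>] assms len letters by auto

lemma rewrite_at_words:
  assumes "\<sigma> \<in> words k n" "i + length \<tau> \<le> n"
  shows "rewrite_at \<tau> \<tau>' i \<sigma> \<in> words k n"
proof -
  have "rewrite_at \<tau> \<tau>' i \<sigma> ! p \<in> set \<sigma>" if p: "p < length \<sigma>" for p
  proof (cases "i \<le> p \<and> p < i + length \<tau>")
    case True
    then have "letter_pos \<tau> (\<tau>' ! (p - i)) < length \<tau>"
      by (intro letter_pos_nth) auto
    then have "i + letter_pos \<tau> (\<tau>' ! (p - i)) < length \<sigma>"
      using assms by (simp add: words_def)
    then show ?thesis
      using p True by (simp add: nth_rewrite_at)
  next
    case False
    then show ?thesis
      using p by (auto simp: nth_rewrite_at)
  qed
  then have "set (rewrite_at \<tau> \<tau>' i \<sigma>) \<subseteq> set \<sigma>"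
    by (auto simp: in_set_conv_nth[of _ "rewrite_at \<tau> \<tau>' i \<sigma>"])
  then show ?thesis
    using assms by (auto simp: words_def)
qed

lemma nth_rewrite_at_factor:
  assumes "i \<in> occurrences \<tau> \<sigma>" "p < length \<tau>"
  shows "rewrite_at \<tau> \<tau>' i \<sigma> ! (i + p) = \<sigma> ! (i + letter_pos \<tau> (\<tau>' ! p))"
  using assms by (simp add: in_occurrences_iff nth_rewrite_at)

text \<open>Passing from pattern letters to their representatives in \<open>\<sigma>\<close>
  preserves and reflects \<open><\<close> and \<open>=\<close>, so the new factor is ordered like
  \<open>\<tau>'\<close>.\<close>

lemma rewrite_at_occurrence:
  assumes "i \<in> occurrences \<tau> \<sigma>"
  shows "i \<in> occurrences \<tau>' (rewrite_at \<tau> \<tau>' i \<sigma>)"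
proof -
  note nth_rewrite_at_factor[OF assms] letter_pos_nth
  then show ?thesis
    using assms by (simp add: in_occurrences_iff len[symmetric])
qed

text \<open>The range deliberately includes both end positions of the factor: they keep their
  letters because the patterns agree in their first and last letters.\<close>

lemma nth_rewrite_at_outside:
  assumes i: "i \<in> occurrences \<tau> \<sigma>" and p: "p < length \<sigma>"
    and outside: "p \<le> i \<or> i + (length \<tau> - 1) \<le> p"
  shows "rewrite_at \<tau> \<tau>' i \<sigma> ! p = \<sigma> ! p"
proof -
  consider "p = i" | "p = i + (length \<tau> - 1)" | "p < i \<or> i + length \<tau> \<le> p"
    using outside by linarith
  then show ?thesis
  proof cases
    case 1
    have "\<tau>' ! 0 = \<tau> ! 0"
      using hd ne len by (metis hd_conv_nth length_0_conv)
    then show ?thesis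
      using 1 nth_rewrite_at_factor[OF i, of 0] nth_letter_pos_occurrence[OF i, of 0] ne by simp
  next
    case 2
    have "\<tau>' ! (length \<tau> - 1) = \<tau> ! (length \<tau> - 1)"
      using last ne len by (metis last_conv_nth length_0_conv)
    then show ?thesis
      using 2 nth_rewrite_at_factor[OF i, of "length \<tau> - 1"]
        nth_letter_pos_occurrence[OF i, of "length \<tau> - 1"] ne by simp
  next
    case 3
    then show ?thesis
      using p by (auto simp: nth_rewrite_at)
  qed
qed

text \<open>Another factor meets the rewritten one at most in an end position, where nothing
  changes. The pattern \<open>\<rho>\<close> is left open because occurrences of both
  \<open>\<tau>\<close> and \<open>\<tau>'\<close> must survive.\<close>

lemma rewrite_at_other_occurrence:
  assumes i: "i \<in> occurrences \<tau> \<sigma>" and j: "j \<in> occurrences \<rho> \<sigma>" and "length \<rho> = length \<tau>"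
    and "i \<noteq> j" "spaced (length \<tau> - 1) {i, j}"
  shows "j \<in> occurrences \<rho> (rewrite_at \<tau> \<tau>' i \<sigma>)"
proof -
  have "rewrite_at \<tau> \<tau>' i \<sigma> ! (j + p) = \<sigma> ! (j + p)" if "p < length \<rho>" for p
  proof (rule nth_rewrite_at_outside[OF i])
    show "j + p < length \<sigma>"
      using j that by (auto simp: in_occurrences_iff)
    show "j + p \<le> i \<or> i + (length \<tau> - 1) \<le> j + p"
      using assms that by (cases "i < j") (auto simp: spaced_def)
  qed
  then show ?thesis
    using j occurrences_cong[of "rewrite_at \<tau> \<tau>' i \<sigma>" \<sigma> \<rho> j] by simp
qed

lemma rewrite_at_inj: "inj_on (rewrite_at \<tau> \<tau>' i) {\<sigma> \<in> words k n. i \<in> occurrences \<tau> \<sigma>}"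
proof (rule inj_onI)
  fix u v
  assume "u \<in> {\<sigma> \<in> words k n. i \<in> occurrences \<tau> \<sigma>}" "v \<in> {\<sigma> \<in> words k n. i \<in> occurrences \<tau> \<sigma>}"
    and eq: "rewrite_at \<tau> \<tau>' i u = rewrite_at \<tau> \<tau>' i v"
  then have u: "length u = n" "i \<in> occurrences \<tau> u" and v: "length v = n" "i \<in> occurrences \<tau> v"
    by (auto simp: words_def)
  show "u = v"
  proof (rule nth_equalityI)
    fix p assume p: "p < length u"
    show "u ! p = v ! p"
    proof (cases "i \<le> p \<and> p < i + length \<tau>")
      case True
      define q where "q = p - i"
      have q: "q < length \<tau>" "p = i + q"
        using True by (auto simp: q_def)
      \<comment> \<open>No letter of the old factor is lost: the pattern letter at \<open>q\<close>
        also occurs in \<open>\<tau>'\<close>, and there the rewritten word shows its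
        representative.\<close>
      have "\<tau> ! q \<in> set \<tau>'"
        using nth_mem[OF q(1)] letters by simp
      then obtain r where r: "r < length \<tau>" "\<tau>' ! r = \<tau> ! q"
        using len by (metis in_set_conv_nth)
      have "u ! (i + letter_pos \<tau> (\<tau> ! q)) = v ! (i + letter_pos \<tau> (\<tau> ! q))"
        using nth_rewrite_at_factor[OF u(2) r(1)] nth_rewrite_at_factor[OF v(2) r(1)] eq r(2)
        by simp
      then show ?thesis
        using nth_letter_pos_occurrence[OF u(2) q(1)] nth_letter_pos_occurrence[OF v(2) q(1)] q(2)
        by simp
    next
      case False
      then have "rewrite_at \<tau> \<tau>' i u ! p = u ! p" "rewrite_at \<tau> \<tau>' i v ! p = v ! p"
        using p u v by (auto simp: nth_rewrite_at)
      then show ?thesis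
        using eq by simp
    qed
  qed (simp add: u v)
qed

text \<open>Rewriting at \<open>i\<close> is an injection that moves \<open>i\<close> from the
  positions prescribed for \<open>\<tau>\<close> to those prescribed for
  \<open>\<tau>'\<close>.\<close>

lemma card_rewrite_at_le:
  assumes "spaced (length \<tau> - 1) (insert i (S \<union> T))" "i \<notin> S \<union> T"
  shows "card {\<sigma> \<in> words k n. insert i S \<subseteq> occurrences \<tau> \<sigma> \<and> T \<subseteq> occurrences \<tau>' \<sigma>}
    \<le> card {\<sigma> \<in> words k n. S \<subseteq> occurrences \<tau> \<sigma> \<and> insert i T \<subseteq> occurrences \<tau>' \<sigma>}"
    (is "card ?A \<le> card ?B")
proof (rule card_inj_on_le)
  show "inj_on (rewrite_at \<tau> \<tau>' i) ?A"
    by (rule inj_on_subset[OF rewrite_at_inj[of i k n]]) auto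
  show "finite ?B"
    by (simp add: finite_words)
  show "rewrite_at \<tau> \<tau>' i ` ?A \<subseteq> ?B"
  proof (rule image_subsetI)
    fix \<sigma> assume \<sigma>: "\<sigma> \<in> ?A"
    then have w: "\<sigma> \<in> words k n" and i: "i \<in> occurrences \<tau> \<sigma>"
      by auto
    have "i + length \<tau> \<le> n"
      using w i by (simp add: in_occurrences_iff words_def)
    then have "rewrite_at \<tau> \<tau>' i \<sigma> \<in> words k n"
      using w by (rule rewrite_at_words[rotated])
    moreover have "spaced (length \<tau> - 1) {i, j}" "i \<noteq> j" if "j \<in> S \<union> T" for j
      using assms that by (auto simp: spaced_def)
    then have "j \<in> occurrences \<rho> (rewrite_at \<tau> \<tau>' i \<sigma>)"
      if "j \<in> S \<union> T" "j \<in> occurrences \<rho> \<sigma>" "length \<rho> = length \<tau>" for j \<rho>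
      using rewrite_at_other_occurrence[OF i] that by blast
    then have "S \<subseteq> occurrences \<tau> (rewrite_at \<tau> \<tau>' i \<sigma>)"
      "T \<subseteq> occurrences \<tau>' (rewrite_at \<tau> \<tau>' i \<sigma>)"
      using \<sigma> len by auto
    ultimately show "rewrite_at \<tau> \<tau>' i \<sigma> \<in> ?B"
      using rewrite_at_occurrence[OF i] by simp
  qed
qed

end

section \<open>Counting words by their sets of occurrences\<close>

lemma card_superset_occurrences_eq:
  assumes \<tau>: "length \<tau> = length \<tau>'" "set \<tau> = set \<tau>'" "\<tau> \<noteq> []" "hd \<tau> = hd \<tau>'" "last \<tau> = last \<tau>'"
    and "finite S" "spaced (length \<tau> - 1) S"
  shows "card {\<sigma> \<in> words k n. S \<subseteq> occurrences \<tau> \<sigma>} = card {\<sigma> \<in> words k n. S \<subseteq> occurrences \<tau>' \<sigma>}"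
proof -
  \<comment> \<open>The set \<open>T\<close> collects the positions already converted to
    \<open>\<tau>'\<close>; the induction moves them over one at a time while
    \<open>S \<union> T\<close> stays fixed. The claim is the case \<open>T = {}\<close>.\<close>
  have "card {\<sigma> \<in> words k n. S \<subseteq> occurrences \<tau> \<sigma> \<and> T \<subseteq> occurrences \<tau>' \<sigma>}
      = card {\<sigma> \<in> words k n. S \<union> T \<subseteq> occurrences \<tau>' \<sigma>}"
    if "spaced (length \<tau> - 1) (S \<union> T)" "S \<inter> T = {}" for T
    using \<open>finite S\<close> that
  proof (induction S arbitrary: T rule: finite_induct)
    case empty
    then show ?case by simp
  next
    case (insert i S)
    have sp: "spaced (length \<tau> - 1) (insert i (S \<union> T))" "spaced (length \<tau>' - 1) (insert i (T \<union> S))"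
      and i: "i \<notin> S \<union> T" "i \<notin> T \<union> S"
      using insert.prems insert.hyps \<tau>(1) by (auto simp: Un_commute)
    have "\<tau>' \<noteq> []"
      using \<tau>(1,3) by auto
    \<comment> \<open>The assumptions are symmetric in the two patterns, so exchanging them,
      together with \<open>S\<close> and \<open>T\<close>, gives the reverse inequality.\<close>
    note le = card_rewrite_at_le[OF \<tau> sp(1) i(1)]
      card_rewrite_at_le[OF \<tau>(1)[symmetric] \<tau>(2)[symmetric] \<open>\<tau>' \<noteq> []\<close> \<tau>(4)[symmetric]
        \<tau>(5)[symmetric] sp(2) i(2)]
    have "card {\<sigma> \<in> words k n. insert i S \<subseteq> occurrences \<tau> \<sigma> \<and> T \<subseteq> occurrences \<tau>' \<sigma>}
        = card {\<sigma> \<in> words k n. S \<subseteq> occurrences \<tau> \<sigma> \<and> insert i T \<subseteq> occurrences \<tau>' \<sigma>}"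
      using le[of k n] by (intro antisym) (simp_all only: conj_commute)
    also have "\<dots> = card {\<sigma> \<in> words k n. S \<union> insert i T \<subseteq> occurrences \<tau>' \<sigma>}"
      using insert.prems insert.hyps by (intro insert.IH) auto
    finally show ?case
      by simp
  qed
  from this[of "{}"] show ?thesis
    using assms by simp
qed

text \<open>Inclusion-exclusion without signs: the words with \<open>f w = S\<close> are those with
  \<open>S \<subseteq> f w\<close> minus those whose value is a strictly larger set, and the latter
  are counted by descending induction on \<open>S\<close>.\<close>

lemma card_fibre_eq_if_card_superset_eq:
  assumes "finite W" "finite U" and f: "\<And>w. w \<in> W \<Longrightarrow> f w \<subseteq> U" and g: "\<And>w. w \<in> W \<Longrightarrow> g w \<subseteq> U"
    and eq: "\<And>S. S \<subseteq> U \<Longrightarrow> card {w \<in> W. S \<subseteq> f w} = card {w \<in> W. S \<subseteq> g w}"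
    and "S \<subseteq> U"
  shows "card {w \<in> W. f w = S} = card {w \<in> W. g w = S}"
  using \<open>S \<subseteq> U\<close>
proof (induction "card (U - S)" arbitrary: S rule: less_induct)
  case less
  have split: "card {w \<in> W. S \<subseteq> h w}
      = card {w \<in> W. h w = S} + (\<Sum>T | S \<subset> T \<and> T \<subseteq> U. card {w \<in> W. h w = T})"
    if "\<And>w. w \<in> W \<Longrightarrow> h w \<subseteq> U" for h
  proof -
    have fin: "finite {T. S \<subset> T \<and> T \<subseteq> U}"
      using \<open>finite U\<close> by simp
    have "{w \<in> W. S \<subseteq> h w} = {w \<in> W. h w = S} \<union> (\<Union>T\<in>{T. S \<subset> T \<and> T \<subseteq> U}. {w \<in> W. h w = T})"
      using that by auto
    then have "card {w \<in> W. S \<subseteq> h w}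
        = card {w \<in> W. h w = S} + card (\<Union>T\<in>{T. S \<subset> T \<and> T \<subseteq> U}. {w \<in> W. h w = T})"
      using \<open>finite W\<close> fin by (simp only:) (rule card_Un_disjoint, auto)
    also have "card (\<Union>T\<in>{T. S \<subset> T \<and> T \<subseteq> U}. {w \<in> W. h w = T})
        = (\<Sum>T | S \<subset> T \<and> T \<subseteq> U. card {w \<in> W. h w = T})"
      using \<open>finite W\<close> fin by (intro card_UN_disjoint) auto
    finally show ?thesis .
  qed
  have "(\<Sum>T | S \<subset> T \<and> T \<subseteq> U. card {w \<in> W. f w = T})
      = (\<Sum>T | S \<subset> T \<and> T \<subseteq> U. card {w \<in> W. g w = T})"
  proof (rule sum.cong)
    fix T assume "T \<in> {T. S \<subset> T \<and> T \<subseteq> U}"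
    then have T: "S \<subset> T" "T \<subseteq> U" by auto
    then have "card (U - T) < card (U - S)"
      using \<open>finite U\<close> by (intro psubset_card_mono) auto
    then show "card {w \<in> W. f w = T} = card {w \<in> W. g w = T}"
      using T(2) by (rule less.hyps)
  qed simp
  then show ?case
    using split[of f, OF f] split[of g, OF g] eq[OF less.prems] by simp
qed

theorem theorem4p3:
  fixes m l a b :: nat and \<tau> \<tau>' :: "nat list"
  assumes "a \<in> {1..m}" and "b \<in> {1..m}" and "a < b"
    and "subword_pattern m l \<tau>" and "primitive \<tau>" and "hd \<tau> = a" and "last \<tau> = b"
    and "subword_pattern m l \<tau>'" and "primitive \<tau>'" and "hd \<tau>' = a" and "last \<tau>' = b"
  shows "strongly_Wilf_equivalent \<tau> \<tau>'"
  unfolding strongly_Wilf_equivalent_def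
proof (intro allI impI)
  fix k n r :: nat
  \<comment> \<open>The patterns are nonempty because their letter set \<open>{1..m}\<close>
    contains \<open>a\<close>.\<close>
  have \<tau>: "length \<tau> = length \<tau>'" "set \<tau> = set \<tau>'" "\<tau> \<noteq> []" "hd \<tau> = hd \<tau>'" "last \<tau> = last \<tau>'"
    using assms by (auto simp: subword_pattern_def words_def)
  \<comment> \<open>A crude bound suffices: any finite set containing all possible occurrences would
    do.\<close>
  let ?U = "{..n}"
  have sub: "occurrences \<rho> \<sigma> \<subseteq> ?U" if "\<sigma> \<in> words k n" for \<rho> \<sigma>
    using that occurrences_subset[of \<rho> \<sigma>] by (simp add: words_def)
  have superset: "card {\<sigma> \<in> words k n. S \<subseteq> occurrences \<tau> \<sigma>}
      = card {\<sigma> \<in> words k n. S \<subseteq> occurrences \<tau>' \<sigma>}" if "S \<subseteq> ?U" for S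
  proof (cases "spaced (length \<tau> - 1) S")
    case True
    have "finite S"
      using that by (rule finite_subset) simp
    then show ?thesis
      using True by (rule card_superset_occurrences_eq[OF \<tau>])
  next
    case False
    \<comment> \<open>Primitivity enters here, for both patterns: if two positions of
      \<open>S\<close> are too close, no word has occurrences at all of \<open>S\<close>, and both
      counts vanish.\<close>
    have "\<not> S \<subseteq> occurrences \<rho> \<sigma>"
      if "primitive \<rho>" "length \<rho> = length \<tau>" "\<sigma> \<in> words k n" for \<rho> \<sigma>
    proof
      assume "S \<subseteq> occurrences \<rho> \<sigma>"
      then have "spaced (length \<tau> - 1) S"
        using primitive_spaced[OF that(1,3)] that(2) unfolding spaced_def by auto
      with False show False ..
    qed
    then have "{\<sigma> \<in> words k n. S \<subseteq> occurrences \<tau> \<sigma>} = {}"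
      "{\<sigma> \<in> words k n. S \<subseteq> occurrences \<tau>' \<sigma>} = {}"
      using assms(5,9) \<tau>(1) by auto
    then show ?thesis
      by (simp only:)
  qed
  have fibre: "card {\<sigma> \<in> words k n. occurrences \<tau> \<sigma> = S}
      = card {\<sigma> \<in> words k n. occurrences \<tau>' \<sigma> = S}" if "S \<subseteq> ?U" for S
    by (rule card_fibre_eq_if_card_superset_eq[OF finite_words _ sub sub superset that]) simp_all
  \<comment> \<open>Sorting the words by their exact occurrence set reduces the count for
    \<open>r\<close> to the fibres over sets of size \<open>r\<close>.\<close>
  have by_set: "card {\<sigma> \<in> words k n. card (occurrences \<rho> \<sigma>) = r}
      = (\<Sum>S | S \<subseteq> ?U \<and> card S = r. card {\<sigma> \<in> words k n. occurrences \<rho> \<sigma> = S})" for \<rho>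
  proof -
    have "{\<sigma> \<in> words k n. card (occurrences \<rho> \<sigma>) = r}
        = (\<Union>S\<in>{S. S \<subseteq> ?U \<and> card S = r}. {\<sigma> \<in> words k n. occurrences \<rho> \<sigma> = S})"
      using sub by auto
    then show ?thesis
      by (simp only:) (rule card_UN_disjoint, auto simp: finite_words)
  qed
  show "card {\<sigma> \<in> words k n. card (occurrences \<tau> \<sigma>) = r}
      = card {\<sigma> \<in> words k n. card (occurrences \<tau>' \<sigma>) = r}"
    unfolding by_set by (rule sum.cong) (auto intro: fibre)
qed

end
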